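(* Let $k$ be a field and let $R=k[H]=k[t^a,t^b]\subseteq k[t]$, where $H=\langle a,b\rangle$ and $1<a<b$ are coprime integers. Suppose $z$ is a witness to $\mathbf{ggl}(R)$. Then $(z)=(t^{ia})$ for some $1\le i\le 1+b-a$.
   Context: The ring $R$ is positively graded by giving $t^c$ degree $c$. For a positively graded Noetherian $k$-algebra $R=\bigoplus_{i\ge 0}R_i$ with $R_0=k$, put $\mathfrak{m}_n=\bigoplus_{i\ge n}R_i$; the generalized graded length $\mathbf{ggl}(R)$ is the smallest positive integer $n$ for which $\mathfrak{m}_n$ is contained in the ideal generated by some homogeneous system of parameters of $R$. A witness to $g=\mathbf{ggl}(R)$ is a homogeneous system of parameters generating an ideal that contains $\mathfrak{m}_g$; here $\dim R=1$, so it is a single homogeneous element $z$ with $\mathfrak{m}_g\subseteq (z)$. *)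

theory Defs
  imports
    "HOL-Algebra.Algebra"
    "HOL-Algebra.Algebraic_Closure_Type"
    "HOL-Computational_Algebra.Polynomial"
    "HOL-Library.Extended_Nat"
begin

text \<open>
  A grading of a ring \<open>R\<close> is a family \<open>G\<close> of subsets of its carrier, \<open>G i\<close> being the component
  of degree \<open>i\<close>.  The notions below are meant for positively graded Noetherian algebras over a
  field \<open>k\<close> with \<open>G 0 = k\<close>; for these \<open>graded_tail R G 1\<close> is the homogeneous maximal ideal.
\<close>

definition krull_dim :: "('a, 'm) ring_scheme \<Rightarrow> enat" where
  "krull_dim R = Sup {enat n | n. \<exists>P :: nat \<Rightarrow> 'a set.
     (\<forall>i\<le>n. primeideal (P i) R) \<and> (\<forall>i<n. P i \<subset> P (Suc i))}"

definition ideal_radical :: "('a, 'm) ring_scheme \<Rightarrow> 'a set \<Rightarrow> 'a set" where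
  "ideal_radical R I = {x \<in> carrier R. \<exists>n::nat. x [^]\<^bsub>R\<^esub> n \<in> I}"

text \<open>The direct sum of the components of degree at least \<open>n\<close>, as the additive subgroup they
  generate.\<close>

definition graded_tail :: "('a, 'm) ring_scheme \<Rightarrow> (nat \<Rightarrow> 'a set) \<Rightarrow> nat \<Rightarrow> 'a set" where
  "graded_tail R G n = generate (add_monoid R) (\<Union>i\<in>{n..}. G i)"

definition homogeneous_sop ::
    "('a, 'm) ring_scheme \<Rightarrow> (nat \<Rightarrow> 'a set) \<Rightarrow> 'a list \<Rightarrow> bool" where
  "homogeneous_sop R G zs \<longleftrightarrow>
     enat (length zs) = krull_dim R \<and>
     (\<forall>z\<in>set zs. \<exists>i\<ge>1. z \<in> G i) \<and>
     ideal_radical R (genideal R (set zs)) = graded_tail R G 1"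

definition ggl :: "('a, 'm) ring_scheme \<Rightarrow> (nat \<Rightarrow> 'a set) \<Rightarrow> nat" where
  "ggl R G = (LEAST n. 1 \<le> n \<and>
     (\<exists>zs. homogeneous_sop R G zs \<and> graded_tail R G n \<subseteq> genideal R (set zs)))"

definition ggl_witness ::
    "('a, 'm) ring_scheme \<Rightarrow> (nat \<Rightarrow> 'a set) \<Rightarrow> 'a list \<Rightarrow> bool" where
  "ggl_witness R G zs \<longleftrightarrow>
     homogeneous_sop R G zs \<and> graded_tail R G (ggl R G) \<subseteq> genideal R (set zs)"

definition numerical_semigroup :: "nat \<Rightarrow> nat \<Rightarrow> nat set" where
  "numerical_semigroup a b = {m * a + n * b | m n. True}"

text \<open>The semigroup ring \<open>k[H]\<close> as a subring of \<open>k[t]\<close>: the polynomials whose exponents all lie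
  in \<open>H\<close>.\<close>

definition semigroup_ring :: "nat set \<Rightarrow> 'k::field poly ring" where
  "semigroup_ring H = ring_of_type_algebra
     \<lparr> carrier := {p. \<forall>n. Polynomial.coeff p n \<noteq> 0 \<longrightarrow> n \<in> H} \<rparr>"

definition semigroup_grading :: "nat set \<Rightarrow> nat \<Rightarrow> 'k::field poly set" where
  "semigroup_grading H i =
     {p \<in> carrier (semigroup_ring H). \<exists>c. p = Polynomial.monom c i}"

text \<open>The semigroup ring of \<open>\<langle>a, b\<rangle>\<close> is the subalgebra \<open>k[t\<^sup>a, t\<^sup>b]\<close>.\<close>

lemma semigroup_ring_eq_generated:
  "carrier (semigroup_ring (numerical_semigroup a b)) =
     generate_ring ring_of_type_algebra
       (range (\<lambda>c::'k::field. [:c:]) \<union> {Polynomial.monom 1 a, Polynomial.monom 1 b})"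
  (is "?C = generate_ring ?P ?S")
proof
  interpret P: cring "?P :: 'k poly ring" by (rule cring_from_type_algebra)
  have ops: "carrier ?P = (UNIV :: 'k poly set)" "x \<otimes>\<^bsub>?P\<^esub> y = x * y" "x \<oplus>\<^bsub>?P\<^esub> y = x + y"
    "\<one>\<^bsub>?P\<^esub> = 1" "\<zero>\<^bsub>?P\<^esub> = 0" for x y :: "'k poly"
    by (simp_all add: ring_of_type_algebra_def)
  have uminus: "\<ominus>\<^bsub>?P\<^esub> x = - x" for x :: "'k poly"
    by (rule P.minus_equality) (simp_all add: ops)
  have C: "?C = {p :: 'k poly. \<forall>n. Polynomial.coeff p n \<noteq> 0 \<longrightarrow> n \<in> numerical_semigroup a b}"
    by (simp add: semigroup_ring_def)
  have H0: "0 \<in> numerical_semigroup a b" and Ha: "a \<in> numerical_semigroup a b"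
    and Hb: "b \<in> numerical_semigroup a b"
    unfolding numerical_semigroup_def by (force intro: exI[of _ 0] exI[of _ 1])+
  have Hadd: "x + y \<in> numerical_semigroup a b"
    if "x \<in> numerical_semigroup a b" "y \<in> numerical_semigroup a b" for x y
  proof -
    from that obtain m n m' n' where "x = m * a + n * b" "y = m' * a + n' * b"
      unfolding numerical_semigroup_def by blast
    then have "x + y = (m + m') * a + (n + n') * b"
      by (simp add: algebra_simps)
    then show ?thesis unfolding numerical_semigroup_def by blast
  qed
  show "generate_ring ?P ?S \<subseteq> ?C"
  proof
    fix p assume "p \<in> generate_ring ?P ?S"
    then show "p \<in> ?C"
    proof induction
      case one
      then show ?case using H0 by (auto simp: C ops coeff_1)
    next
      case (incl h)
      then show ?case using H0 Ha Hb
        by (auto simp: C coeff_pCons split: nat.splits if_splits)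
    next
      case (a_inv h)
      then show ?case by (simp add: C uminus)
    next
      case (eng_add h1 h2)
      then show ?case by (simp add: C ops) (metis add_0)
    next
      case (eng_mult h1 h2)
      show ?case unfolding C ops
      proof (intro CollectI allI impI)
        fix n assume "Polynomial.coeff (h1 * h2) n \<noteq> 0"
        then obtain i where "i \<le> n" "Polynomial.coeff h1 i * Polynomial.coeff h2 (n - i) \<noteq> 0"
          unfolding coeff_mult by (metis (no_types, lifting) sum.neutral atMost_iff)
        then show "n \<in> numerical_semigroup a b"
          using eng_mult.IH Hadd[of i "n - i"] by (auto simp: C)
      qed
    qed
  qed
  let ?G = "generate_ring ?P ?S"
  have mult: "x * y \<in> ?G" if "x \<in> ?G" "y \<in> ?G" for x y
    using generate_ring.eng_mult[OF that] by (simp add: ops)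
  have add: "x + y \<in> ?G" if "x \<in> ?G" "y \<in> ?G" for x y
    using generate_ring.eng_add[OF that] by (simp add: ops)
  have const: "[:c:] \<in> ?G" for c by (rule generate_ring.incl) simp
  have pow: "x ^ n \<in> ?G" if "x \<in> ?G" for x n
    by (induction n) (use const[of 1] that mult in \<open>auto simp: one_pCons\<close>)
  have gen: "Polynomial.monom 1 a \<in> ?G" "Polynomial.monom 1 b \<in> ?G"
    by (rule generate_ring.incl, simp)+
  have mon: "Polynomial.monom c n \<in> ?G" if "n \<in> numerical_semigroup a b" for c n
  proof -
    from that obtain i j where n: "n = i * a + j * b"
      unfolding numerical_semigroup_def by blast
    have "Polynomial.monom c n =
        [:c:] * (Polynomial.monom 1 a ^ i * Polynomial.monom 1 b ^ j)"
      by (simp add: n monom_power mult_monom smult_monom mult.commute)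
    then show ?thesis using const gen mult pow by metis
  qed
  have zero: "0 \<in> ?G" using const[of 0] by simp
  show "?C \<subseteq> ?G"
  proof
    fix p :: "'k poly" assume p: "p \<in> ?C"
    have m: "Polynomial.monom (Polynomial.coeff p i) i \<in> ?G" for i
      using p mon zero by (cases "Polynomial.coeff p i = 0") (auto simp: C)
    have sum: "(\<Sum>i\<in>A. Polynomial.monom (Polynomial.coeff p i) i) \<in> ?G" if "finite A" for A
      using that by (induction rule: finite_induct) (simp_all only: sum.empty sum.insert zero add m not_False_eq_True)
    show "p \<in> ?G"
      using sum[of "{..Polynomial.degree p}"] unfolding poly_as_sum_of_monoms by simp
  qed
qed

end

theory Submission
  imports Defs "HOL-Number_Theory.Cong"
begin

text \<open>
  Let \<open>f\<close> be the Frobenius number of \<open>H = \<langle>a, b\<rangle>\<close>, the largest number outside \<open>H\<close>. A nonzero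
  homogeneous element of positive degree is \<open>c t\<^sup>h\<close> with \<open>h \<in> H\<close>, \<open>h \<ge> 1\<close>, and it generates the
  span of the monomials with exponent in \<open>h + H\<close>. The largest element of \<open>H\<close> that is not in
  \<open>h + H\<close> is \<open>f + h\<close>: it lies in \<open>H\<close> because it exceeds \<open>f\<close>, and beyond it \<open>n - h\<close> exceeds \<open>f\<close>.
  So \<open>(t\<^sup>h)\<close> contains all components of degree at least \<open>n\<close> exactly when \<open>n > f + h\<close>
  (\<open>graded_tail_subset_genideal_monom_iff\<close>).

  The least such \<open>n\<close> grows strictly with \<open>h\<close>, so the optimal parameter is the one of smallest
  degree. Since \<open>t\<^sup>a\<close> is itself a homogeneous parameter (\<open>radical_genideal_monom\<close>), the
  generalized graded length is at most \<open>f + a + 1\<close>, while a witness of degree \<open>h\<close> forces it to be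
  at least \<open>f + h + 1\<close>. Hence \<open>h = a\<close>, and the index in the conclusion can be taken to be \<open>1\<close>.

  The argument works for every submonoid of the natural numbers with finite nonempty
  complement, with \<open>a\<close> replaced by the least positive element (\<open>ggl_witness_monom\<close>). For
  \<open>\<langle>a, b\<rangle>\<close>, coprimality makes the complement finite, \<open>1 < a\<close> makes it nonempty, and \<open>a < b\<close>
  makes \<open>a\<close> the least positive element.
\<close>

section \<open>Monomial ideals of a semigroup ring\<close>

locale nat_submonoid =
  fixes H :: "nat set"
  assumes zero_mem: "0 \<in> H"
    and add_mem: "x \<in> H \<Longrightarrow> y \<in> H \<Longrightarrow> x + y \<in> H"
begin

lemma semigroup_ring_simps:
  "carrier (semigroup_ring H :: 'k::field poly ring) = {p. \<forall>n. Polynomial.coeff p n \<noteq> 0 \<longrightarrow> n \<in> H}"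
  "x \<otimes>\<^bsub>semigroup_ring H\<^esub> y = x * y"
  "x \<oplus>\<^bsub>semigroup_ring H\<^esub> y = x + y"
  "\<one>\<^bsub>semigroup_ring H\<^esub> = 1" "\<zero>\<^bsub>semigroup_ring H\<^esub> = 0"
  for x y :: "'k::field poly"
  by (simp_all add: semigroup_ring_def ring_of_type_algebra_def)

lemma semigroup_ring_pow: "x [^]\<^bsub>semigroup_ring H\<^esub> n = x ^ n"
  for x :: "'k::field poly" and n :: nat
  by (induction n) (simp_all add: semigroup_ring_simps)

lemma coeff_mult_mem:
  fixes p q :: "'k::field poly"
  assumes "\<forall>n. Polynomial.coeff p n \<noteq> 0 \<longrightarrow> n \<in> H" "\<forall>n. Polynomial.coeff q n \<noteq> 0 \<longrightarrow> n \<in> H"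
    and "Polynomial.coeff (p * q) n \<noteq> 0"
  shows "n \<in> H"
proof -
  obtain i where "i \<le> n" "Polynomial.coeff p i * Polynomial.coeff q (n - i) \<noteq> 0"
    using assms(3) unfolding coeff_mult by (metis (no_types, lifting) sum.neutral atMost_iff)
  then show ?thesis
    using assms(1,2) add_mem[of i "n - i"] by auto
qed

lemma cring_semigroup_ring: "cring (semigroup_ring H :: 'k::field poly ring)"
proof -
  let ?R = "semigroup_ring H :: 'k poly ring"
  show ?thesis
  proof (rule cringI)
    show "abelian_group ?R"
    proof (rule abelian_groupI)
      fix x assume "x \<in> carrier ?R"
      then show "\<exists>y\<in>carrier ?R. y \<oplus>\<^bsub>?R\<^esub> x = \<zero>\<^bsub>?R\<^esub>"
        by (intro bexI[of _ "- x"]) (auto simp: semigroup_ring_simps)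
    next
      fix x y assume "x \<in> carrier ?R" "y \<in> carrier ?R"
      then show "x \<oplus>\<^bsub>?R\<^esub> y \<in> carrier ?R"
        by (simp add: semigroup_ring_simps) (metis add_0)
    qed (auto simp: semigroup_ring_simps add_ac)
    show "Group.comm_monoid ?R"
      by (rule Group.comm_monoidI)
         (use coeff_mult_mem in \<open>auto simp: semigroup_ring_simps mult_ac coeff_1 zero_mem\<close>)
  qed (auto simp: semigroup_ring_simps distrib_right)
qed

lemma mem_genideal_monom:
  fixes p :: "'k::field poly"
  assumes "c \<noteq> 0" "h \<in> H"
  shows "p \<in> genideal (semigroup_ring H) {Polynomial.monom c h} \<longleftrightarrow>
    (\<forall>n. Polynomial.coeff p n \<noteq> 0 \<longrightarrow> h \<le> n \<and> n - h \<in> H)"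
proof -
  let ?R = "semigroup_ring H :: 'k poly ring"
  interpret cring ?R by (rule cring_semigroup_ring)
  have mem: "Polynomial.monom c h \<in> carrier ?R"
    using assms(2) by (simp add: semigroup_ring_simps)
  have "genideal ?R {Polynomial.monom c h} = {x * Polynomial.monom c h | x. x \<in> carrier ?R}"
    using cgenideal_eq_genideal[OF mem]
    by (simp add: cgenideal_def semigroup_ring_simps(2))
  moreover have "(\<exists>x\<in>carrier ?R. p = x * Polynomial.monom c h) \<longleftrightarrow>
    (\<forall>n. Polynomial.coeff p n \<noteq> 0 \<longrightarrow> h \<le> n \<and> n - h \<in> H)"
  proof
    assume "\<exists>x\<in>carrier ?R. p = x * Polynomial.monom c h"
    then obtain x where x: "x \<in> carrier ?R" "p = Polynomial.monom c h * x"
      by (auto simp: mult.commute)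
    then show "\<forall>n. Polynomial.coeff p n \<noteq> 0 \<longrightarrow> h \<le> n \<and> n - h \<in> H"
      by (auto simp: coeff_monom_mult semigroup_ring_simps split: if_splits)
  next
    assume R: "\<forall>n. Polynomial.coeff p n \<noteq> 0 \<longrightarrow> h \<le> n \<and> n - h \<in> H"
    then have "Polynomial.monom 1 h dvd p"
      unfolding monom_1_dvd_iff' by (meson not_le)
    then obtain q where q: "p = Polynomial.monom 1 h * q" by blast
    have "p = Polynomial.smult (inverse c) q * Polynomial.monom c h"
      using assms(1) q by (simp add: smult_monom flip: mult_smult_right)
    moreover have "n \<in> H" if "Polynomial.coeff q n \<noteq> 0" for n
      using R[rule_format, of "n + h"] that by (simp add: q coeff_monom_mult)
    then have "Polynomial.smult (inverse c) q \<in> carrier ?R"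
      by (simp add: semigroup_ring_simps)
    ultimately show "\<exists>x\<in>carrier ?R. p = x * Polynomial.monom c h" by blast
  qed
  ultimately show ?thesis by auto
qed

lemma mem_semigroup_grading:
  "p \<in> semigroup_grading H i \<longleftrightarrow> (\<exists>c. p = Polynomial.monom c i \<and> (c \<noteq> 0 \<longrightarrow> i \<in> H))"
  for p :: "'k::field poly"
  unfolding semigroup_grading_def by (auto simp: semigroup_ring_simps split: if_splits)

text \<open>
  Both the tails and the ideals generated by a monomial are spans of monomials, so membership in
  either is a condition on the exponents; inclusions between them reduce to inclusions between
  sets of exponents.
\<close>

lemma mem_graded_tail:
  fixes p :: "'k::field poly"
  shows "p \<in> graded_tail (semigroup_ring H) (semigroup_grading H) n \<longleftrightarrow>
    (\<forall>m. Polynomial.coeff p m \<noteq> 0 \<longrightarrow> m \<in> H \<and> n \<le> m)"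
  (is "p \<in> ?T \<longleftrightarrow> ?C p")
proof
  let ?R = "semigroup_ring H :: 'k poly ring"
  interpret cring ?R by (rule cring_semigroup_ring)
  let ?U = "\<Union>i\<in>{n..}. semigroup_grading H i :: 'k poly set"
  have U: "?U \<subseteq> carrier (add_monoid ?R)"
    by (auto simp: semigroup_grading_def)
  have T: "?T = generate (add_monoid ?R) ?U" by (simp add: graded_tail_def)
  have uminus: "inv\<^bsub>add_monoid ?R\<^esub> x = - x" if "x \<in> carrier ?R" for x
    using minus_equality[of "- x" x] that unfolding a_inv_def
    by (simp add: semigroup_ring_simps)
  show "?C p" if "p \<in> ?T"
    using that unfolding T
  proof induction
    case (inv h)
    then have "h \<in> carrier ?R" using U by auto
    then have "inv\<^bsub>add_monoid ?R\<^esub> h = - h" by (rule uminus)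
    moreover have "?C (- h)" using inv by (auto simp: mem_semigroup_grading split: if_splits)
    ultimately show ?case by (simp only:)
  next
    case (eng h1 h2)
    then show ?case by (simp add: semigroup_ring_simps) (metis add_0)
  qed (auto simp: semigroup_ring_simps mem_semigroup_grading split: if_splits)
  assume p: "?C p"
  have zero: "0 \<in> ?T"
    using generate.one[of "add_monoid ?R" ?U] by (simp add: T semigroup_ring_simps)
  have add: "x + y \<in> ?T" if "x \<in> ?T" "y \<in> ?T" for x y
    using generate.eng[of x "add_monoid ?R" ?U y] that by (simp add: T semigroup_ring_simps)
  have mon: "Polynomial.monom (Polynomial.coeff p i) i \<in> ?T" for i
  proof (cases "Polynomial.coeff p i = 0")
    case False
    then have "Polynomial.monom (Polynomial.coeff p i) i \<in> ?U"
      using p by (auto simp: mem_semigroup_grading)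
    then show ?thesis unfolding T by (rule generate.incl)
  qed (simp add: zero)
  have "(\<Sum>i\<in>A. Polynomial.monom (Polynomial.coeff p i) i) \<in> ?T" if "finite A" for A
    using that by induction (simp_all only: sum.empty sum.insert zero add mon not_False_eq_True)
  from this[of "{..Polynomial.degree p}"] show "p \<in> ?T"
    by (simp add: poly_as_sum_of_monoms)
qed

section \<open>The Frobenius number and homogeneous parameters\<close>

text \<open>
  The monomial \<open>t\<^bsup>f + h\<^esup>\<close> is the obstruction of highest degree: its exponent is in \<open>H\<close> because
  \<open>h \<ge> 1\<close>, but subtracting \<open>h\<close> lands on the gap \<open>f\<close>.
\<close>

lemma graded_tail_subset_genideal_monom_iff:
  assumes "h \<in> H" "1 \<le> h" "f \<notin> H" "\<And>n. f < n \<Longrightarrow> n \<in> H" and "c \<noteq> (0 :: 'k::field)"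
  shows "graded_tail (semigroup_ring H) (semigroup_grading H) n
      \<subseteq> genideal (semigroup_ring H) {Polynomial.monom c h} \<longleftrightarrow> f + h < n"
proof
  assume sub: "graded_tail (semigroup_ring H) (semigroup_grading H) n
      \<subseteq> genideal (semigroup_ring H) {Polynomial.monom c h}"
  have "Polynomial.monom c (f + h) \<notin> genideal (semigroup_ring H) {Polynomial.monom c h}"
    using assms by (auto simp: mem_genideal_monom)
  then have "Polynomial.monom c (f + h) \<notin> graded_tail (semigroup_ring H) (semigroup_grading H) n"
    using sub by blast
  then show "f + h < n"
    using assms by (auto simp: mem_graded_tail split: if_splits)
next
  assume "f + h < n"
  then have "h \<le> m \<and> m - h \<in> H" if "n \<le> m" for m
    using that assms(4)[of "m - h"] by linarith
  then show "graded_tail (semigroup_ring H) (semigroup_grading H) n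
      \<subseteq> genideal (semigroup_ring H) {Polynomial.monom c h}"
    using assms by (auto simp: mem_graded_tail mem_genideal_monom)
qed

text \<open>
  If \<open>x\<close> has no constant term, then \<open>x ^ n\<close> has no terms of degree below \<open>n\<close>, and terms of degree
  above \<open>f + h\<close> lie in the ideal of \<open>t\<^sup>h\<close>. Conversely, a power with zero constant term can only
  come from an \<open>x\<close> with zero constant term.
\<close>

lemma radical_genideal_monom:
  assumes "h \<in> H" "1 \<le> h" "\<And>n. f < n \<Longrightarrow> n \<in> H"
  shows "ideal_radical (semigroup_ring H) (genideal (semigroup_ring H) {Polynomial.monom 1 h})
    = graded_tail (semigroup_ring H) (semigroup_grading H :: nat \<Rightarrow> 'k::field poly set) 1"
  (is "ideal_radical ?R ?I = ?T")
proof (intro equalityI subsetI)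
  fix x assume "x \<in> ideal_radical ?R ?I"
  then obtain n :: nat where x: "x \<in> carrier ?R" "x ^ n \<in> ?I"
    by (auto simp: ideal_radical_def semigroup_ring_pow)
  then have "Polynomial.coeff (x ^ n) 0 = 0"
    using assms by (auto simp: mem_genideal_monom)
  then have "Polynomial.coeff x 0 = 0"
    by (simp add: coeff_0_power)
  then show "x \<in> ?T"
    using x(1) by (auto simp: mem_graded_tail semigroup_ring_simps) (metis not_less_eq_eq le0 le_zero_eq)
next
  fix x assume "x \<in> ?T"
  then have x: "x \<in> carrier ?R" "Polynomial.coeff x 0 = 0"
    by (auto simp: mem_graded_tail semigroup_ring_simps)
  let ?N = "Suc (f + h)"
  have "Polynomial.monom 1 1 ^ ?N dvd x ^ ?N"
    using x(2) by (intro dvd_power_same) (simp add: monom_1_dvd_iff')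
  then have "Polynomial.monom 1 ?N dvd x ^ ?N"
    by (simp add: monom_power del: power_Suc)
  then have "\<forall>m<?N. Polynomial.coeff (x ^ ?N) m = 0"
    by (simp only: monom_1_dvd_iff')
  then have "h \<le> m \<and> m - h \<in> H" if "Polynomial.coeff (x ^ ?N) m \<noteq> 0" for m
    using that assms(3)[of "m - h"] by (metis less_diff_conv not_less_eq not_less_iff_gr_or_eq
        add.commute le_add2 le_trans less_imp_le_nat)
  then have "x ^ ?N \<in> ?I"
    using assms by (auto simp: mem_genideal_monom simp del: power_Suc)
  then show "x \<in> ideal_radical ?R ?I"
    using x(1) unfolding ideal_radical_def semigroup_ring_pow by blast
qed

text \<open>
  The witness \<open>[z]\<close> has as many entries as the dimension, so the dimension is one and \<open>[t\<^sup>e]\<close>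
  is a homogeneous system of parameters too. It bounds the generalized graded length by
  \<open>f + e + 1\<close>, which no parameter of degree greater than \<open>e\<close> attains.
\<close>

lemma ggl_witness_monom:
  fixes z :: "'k::field poly"
  assumes f: "f \<notin> H" "\<And>n. f < n \<Longrightarrow> n \<in> H"
    and e: "e \<in> H" "1 \<le> e" "\<And>h. h \<in> H \<Longrightarrow> 1 \<le> h \<Longrightarrow> e \<le> h"
    and z: "ggl_witness (semigroup_ring H) (semigroup_grading H) [z]"
  shows "\<exists>c. c \<noteq> 0 \<and> z = Polynomial.monom c e"
proof -
  let ?R = "semigroup_ring H :: 'k poly ring" and ?G = "semigroup_grading H :: nat \<Rightarrow> 'k poly set"
  interpret cring ?R by (rule cring_semigroup_ring)
  have dim: "enat 1 = krull_dim ?R"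
    and tail: "graded_tail ?R ?G (ggl ?R ?G) \<subseteq> genideal ?R {z}"
    using z by (auto simp: ggl_witness_def homogeneous_sop_def)
  obtain h c where h: "1 \<le> h" and zc: "z = Polynomial.monom c h" and cH: "c \<noteq> 0 \<longrightarrow> h \<in> H"
    using z by (auto simp: ggl_witness_def homogeneous_sop_def mem_semigroup_grading)
  \<comment> \<open>The zero polynomial is homogeneous of every degree, but its ideal contains no tail.\<close>
  have "c \<noteq> 0"
  proof
    assume "c = 0"
    then have "genideal ?R {z} = {0}"
      using genideal_zero by (simp add: zc semigroup_ring_simps)
    moreover have "Polynomial.monom 1 (Suc (f + ggl ?R ?G)) \<in> graded_tail ?R ?G (ggl ?R ?G)"
      using f(2) by (auto simp: mem_graded_tail)
    ultimately show False using tail by auto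
  qed
  then have "h \<in> H" using cH by blast
  have "homogeneous_sop ?R ?G [Polynomial.monom 1 e]"
    using e f dim radical_genideal_monom[OF e(1,2) f(2), where 'k = 'k]
    by (auto simp: homogeneous_sop_def mem_semigroup_grading)
  moreover have "graded_tail ?R ?G (Suc (f + e)) \<subseteq> genideal ?R (set [Polynomial.monom 1 e])"
    using graded_tail_subset_genideal_monom_iff[OF e(1,2) f, of "1 :: 'k"] by simp
  ultimately have "ggl ?R ?G \<le> Suc (f + e)"
    unfolding ggl_def by (intro Least_le) force
  moreover have "f + h < ggl ?R ?G"
    using graded_tail_subset_genideal_monom_iff[OF \<open>h \<in> H\<close> h f \<open>c \<noteq> 0\<close>] tail
    by (simp add: zc)
  ultimately have "h = e" using e(3)[OF \<open>h \<in> H\<close> h] by simp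
  then show ?thesis using zc \<open>c \<noteq> 0\<close> by blast
qed

end

section \<open>The semigroup with two coprime generators\<close>

lemma nat_submonoid_numerical_semigroup: "nat_submonoid (numerical_semigroup a b)"
proof
  show "0 \<in> numerical_semigroup a b"
    unfolding numerical_semigroup_def by force
  fix x y assume "x \<in> numerical_semigroup a b" "y \<in> numerical_semigroup a b"
  then obtain m n m' n' where "x = m * a + n * b" "y = m' * a + n' * b"
    unfolding numerical_semigroup_def by blast
  then have "x + y = (m + m') * a + (n + n') * b"
    by (simp add: algebra_simps)
  then show "x + y \<in> numerical_semigroup a b"
    unfolding numerical_semigroup_def by blast
qed

text \<open>
  As \<open>b\<close> is invertible modulo \<open>a\<close>, some \<open>y < a\<close> has \<open>y * b\<close> congruent to \<open>n\<close>; the bound on \<open>n\<close>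
  makes the difference \<open>n - y * b\<close> a nonnegative multiple of \<open>a\<close>.
\<close>

lemma numerical_semigroup_cofinite:
  assumes "coprime a b" "0 < a" "a * b \<le> n"
  shows "n \<in> numerical_semigroup a b"
proof -
  obtain x where x: "[b * x = 1] (mod a)"
    using cong_solve_coprime_nat[of b a] assms(1) by (auto simp: coprime_commute)
  define y where "y = (x * n) mod a"
  have "[y * b = (b * x) * n] (mod a)"
    unfolding y_def by (simp add: cong_def mod_mult_left_eq) (simp add: mult_ac)
  also have "[(b * x) * n = n] (mod a)"
    using cong_scalar_right[OF x, of n] by simp
  finally have "[y * b = n] (mod a)" .
  moreover have "y * b \<le> n"
    using mult_right_mono[of y a b] mod_less_divisor[OF assms(2), of "x * n"] assms(3)
    unfolding y_def by linarith
  ultimately obtain m where "n = m * a + y * b"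
    by (metis cong_le_nat cong_sym add.commute)
  then show ?thesis unfolding numerical_semigroup_def by blast
qed

lemma numerical_semigroup_multiplicity:
  assumes "a \<le> b" "h \<in> numerical_semigroup a b" "1 \<le> h"
  shows "a \<le> h"
proof -
  obtain m n where h: "h = m * a + n * b"
    using assms(2) unfolding numerical_semigroup_def by blast
  then consider "1 \<le> m" | "1 \<le> n" using assms(3) by (cases "m = 0"; cases "n = 0") auto
  then show ?thesis
  proof cases
    case 1
    then show ?thesis using mult_right_mono[of 1 m a] h by linarith
  next
    case 2
    then show ?thesis using mult_right_mono[of 1 n b] h assms(1) by linarith
  qed
qed

lemma numerical_semigroup_frobenius:
  assumes "coprime a b" "1 < a" "a \<le> b"
  obtains f where "f \<notin> numerical_semigroup a b" "\<And>n. f < n \<Longrightarrow> n \<in> numerical_semigroup a b"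
proof -
  let ?gaps = "- numerical_semigroup a b"
  have "?gaps \<subseteq> {..<a * b}"
    using numerical_semigroup_cofinite[of a b] assms by (auto simp: not_less[symmetric])
  then have fin: "finite ?gaps" by (rule finite_subset) simp
  \<comment> \<open>The maximum of the gaps exists only if there is a gap; \<open>a > 1\<close> makes \<open>1\<close> one.\<close>
  have "1 \<in> ?gaps"
    using numerical_semigroup_multiplicity[of a b 1] assms by auto
  then have "Max ?gaps \<in> ?gaps" using Max_in[OF fin] by blast
  moreover have "n \<in> numerical_semigroup a b" if "Max ?gaps < n" for n
    using Max_ge[OF fin, of n] that by auto
  ultimately show thesis using that by blast
qed

theorem proposition4p6:
  fixes a b :: nat and z :: "'k::field poly"
    and R :: "'k poly ring" and G :: "nat \<Rightarrow> 'k poly set"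
  defines "R \<equiv> semigroup_ring (numerical_semigroup a b)"
    and "G \<equiv> semigroup_grading (numerical_semigroup a b)"
  assumes "1 < a" and "a < b" and "coprime a b"
    and "ggl_witness R G [z]"
  shows "\<exists>i. 1 \<le> i \<and> i \<le> 1 + b - a \<and>
           genideal R {z} = genideal R {Polynomial.monom 1 (i * a)}"
proof -
  interpret nat_submonoid "numerical_semigroup a b"
    by (rule nat_submonoid_numerical_semigroup)
  obtain f where f: "f \<notin> numerical_semigroup a b" "\<And>n. f < n \<Longrightarrow> n \<in> numerical_semigroup a b"
    using numerical_semigroup_frobenius[of a b] assms(3-5) by auto
  have "a = 1 * a + 0 * b" by simp
  then have a: "a \<in> numerical_semigroup a b"
    unfolding numerical_semigroup_def by blast
  obtain c where c: "c \<noteq> 0" "z = Polynomial.monom c a"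
    using ggl_witness_monom[OF f a, of z] numerical_semigroup_multiplicity[of a b] assms
    by auto
  have "genideal R {z} = genideal R {Polynomial.monom 1 (1 * a)}"
    unfolding R_def c(2) by (rule Set.set_eqI) (simp add: mem_genideal_monom a c(1))
  then show ?thesis using \<open>a < b\<close> by (intro exI[of _ 1]) simp
qed

end
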